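(* Let $p,q$ be coprime integers with $|p|+|q|>2$, let $n\ge1$, and let $A,B\in GL_n(\mathbb{C})$ satisfy $B^{-1}A^pB=A^q$. If $A$ is diagonalizable, then $A$ is a root of $I_n$ and $B^{-1}AB$ is a power of $A$.
   Context: A matrix $A\in\mathcal{M}_n(\mathbb{C})$ is a root of $I_n$ if there exists a positive integer $k$ such that $A^k=I_n$. A power of $A$ is a matrix $A^m$ with $m\in\mathbb{Z}$. *)

theory Defs
  imports "Jordan_Normal_Form.Determinant"
begin

(* The general linear group as a group in the sense of HOL-Algebra, so that inverses and
   integer powers are those of the group; the last argument of ring_mat is an unused record
   extension. *)
definition GL :: "nat \<Rightarrow> complex mat monoid" where
  "GL n = units_of (ring_mat TYPE(complex) n ())"

definition diagonalizable :: "'a :: semiring_1 mat \<Rightarrow> bool" where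
  "diagonalizable A \<longleftrightarrow> (\<exists>D. diagonal_mat D \<and> similar_mat A D)"

definition root_of_one_mat :: "nat \<Rightarrow> complex mat \<Rightarrow> bool" where
  "root_of_one_mat n A \<longleftrightarrow> A \<in> carrier_mat n n \<and> (\<exists>k>0. A ^\<^sub>m k = 1\<^sub>m n)"

(* For A in GL n. *)
definition power_of_mat :: "nat \<Rightarrow> complex mat \<Rightarrow> complex mat \<Rightarrow> bool" where
  "power_of_mat n A C \<longleftrightarrow> (\<exists>m::int. C = A [^]\<^bsub>GL n\<^esub> m)"

lemma group_GL: "group (GL n)"
proof -
  interpret ring "ring_mat TYPE(complex) n ()" by (rule ring_mat)
  show ?thesis unfolding GL_def by (rule units_group)
qed

lemma mult_GL [simp]: "A \<otimes>\<^bsub>GL n\<^esub> B = A * B"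
  by (simp add: GL_def units_of_def ring_mat_def)

lemma one_GL [simp]: "\<one>\<^bsub>GL n\<^esub> = 1\<^sub>m n"
  by (simp add: GL_def units_of_def ring_mat_def)

lemma carrier_GL: "A \<in> carrier (GL n) \<longleftrightarrow> A \<in> carrier_mat n n \<and> invertible_mat A"
proof
  assume "A \<in> carrier (GL n)"
  then obtain C where "A \<in> carrier_mat n n" "C \<in> carrier_mat n n" "C * A = 1\<^sub>m n" "A * C = 1\<^sub>m n"
    by (auto simp: GL_def units_of_def ring_mat_def Units_def)
  then show "A \<in> carrier_mat n n \<and> invertible_mat A"
    by (auto simp: invertible_mat_def inverts_mat_def)
next
  assume A: "A \<in> carrier_mat n n \<and> invertible_mat A"
  then obtain C where C: "A * C = 1\<^sub>m n" "C * A = 1\<^sub>m (dim_row C)"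
    by (auto simp: invertible_mat_def inverts_mat_def)
  have "dim_col (A * C) = n" "dim_col (C * A) = dim_row C"
    using C by simp_all
  then have "C \<in> carrier_mat n n"
    using A by auto
  with A C show "A \<in> carrier (GL n)"
    by (auto simp: GL_def units_of_def ring_mat_def Units_def)
qed

lemma nat_pow_GL: "A \<in> carrier_mat n n \<Longrightarrow> A [^]\<^bsub>GL n\<^esub> (k::nat) = A ^\<^sub>m k"
  by (induction k) (simp_all add: nat_pow_def)

end

theory Submission
  imports Defs "HOL-Algebra.Multiplicative_Group"
begin

text \<open>Diagonalizing \<open>A\<close>, the relation shows that the \<open>p\<close>-th power of each eigenvalue is the
  \<open>q\<close>-th power of some eigenvalue. As there are finitely many eigenvalues and \<open>\<bar>p\<bar> \<noteq> \<bar>q\<bar>\<close>, they are all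
  roots of unity, so \<open>A\<close> has finite order \<open>N\<close>. The conjugate elements \<open>A\<^sup>p\<close> and \<open>A\<^sup>q\<close> have the same
  order, hence \<open>p\<close> is coprime to \<open>N\<close>; if \<open>p u \<equiv> 1\<close> modulo \<open>N\<close>, then
  \<open>B\<^sup>-\<^sup>1 A B = (B\<^sup>-\<^sup>1 A\<^sup>p B)\<^sup>u = A\<^sup>q\<^sup>u\<close>.\<close>

section \<open>Conjugation and powers in a group\<close>

lemma (in group) conj_hom:
  assumes "b \<in> carrier G"
  shows "(\<lambda>x. inv b \<otimes> x \<otimes> b) \<in> hom G G"
proof (rule homI)
  fix x y assume xy: "x \<in> carrier G" "y \<in> carrier G"
  have "b \<otimes> (inv b \<otimes> (y \<otimes> b)) = y \<otimes> b"
    using assms xy by (simp flip: m_assoc)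
  with assms xy show "inv b \<otimes> (x \<otimes> y) \<otimes> b = inv b \<otimes> x \<otimes> b \<otimes> (inv b \<otimes> y \<otimes> b)"
    by (simp add: m_assoc)
qed (use assms in simp)

lemma (in group) conj_int_pow:
  assumes "a \<in> carrier G" "b \<in> carrier G"
  shows "inv b \<otimes> a [^] (k :: int) \<otimes> b = (inv b \<otimes> a \<otimes> b) [^] k"
  using hom_int_pow[OF conj_hom[OF assms(2)] assms(1) group_axioms group_axioms] .

lemma (in group) conj_eq_imp_commute:
  assumes "x \<in> carrier G" "c \<in> carrier G" "inv c \<otimes> x \<otimes> c = y"
  shows "x \<otimes> c = c \<otimes> y"
proof -
  have "c \<otimes> y = (c \<otimes> inv c) \<otimes> x \<otimes> c"
    using assms by (auto simp only: m_assoc m_closed inv_closed)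
  then show ?thesis using assms by simp
qed

lemma (in group) conj_eq_int_pow:
  fixes p q :: int
  assumes a: "a \<in> carrier G" and b: "b \<in> carrier G" and "ord a > 0" and "coprime p q"
    and eq: "inv b \<otimes> a [^] p \<otimes> b = a [^] q"
  shows "\<exists>m::int. inv b \<otimes> a \<otimes> b = a [^] m"
proof -
  define N where "N = int (ord a)"
  have "N > 0" using assms by (simp add: N_def)
  define g where "g = gcd p N"
  obtain r s where p: "p = g * r" and N: "N = g * s"
    unfolding g_def by (meson dvdE gcd_dvd1 gcd_dvd2)
  \<comment> \<open>\<open>p * s = r * N\<close>, so this power is trivial. Conjugation by
    \<open>b\<close> carries it to \<open>a [^] (q * s)\<close>, hence \<open>g * s = N\<close>
    divides \<open>q * s\<close>, and cancelling the nonzero \<open>s\<close> leaves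
    \<open>g dvd q\<close>.\<close>
  have "a [^] (p * s) = \<one>"
    using int_pow_eq_id[OF a] by (simp add: p N_def[symmetric] N)
  then have "inv b \<otimes> a [^] (p * s) \<otimes> b = \<one>" using b by simp
  moreover have "inv b \<otimes> a [^] (p * s) \<otimes> b = a [^] (q * s)"
    using conj_int_pow[of "a [^] p" b s] a b eq by (simp add: int_pow_pow)
  ultimately have "N dvd q * s" using int_pow_eq_id[OF a] by (simp add: N_def)
  then have "g dvd q" using \<open>N > 0\<close> by (auto simp: N)
  moreover have "g dvd p" by (simp add: p)
  ultimately have "gcd p N = 1"
    using \<open>coprime p q\<close> not_coprimeI[of g p q] \<open>N > 0\<close> by (auto simp: g_def)
  then obtain u v where uv: "u * p + v * N = 1" using bezout_int[of p N] by auto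
  have "a [^] (v * N) = \<one>" using int_pow_eq_id[OF a] by (simp add: N_def)
  then have "a = a [^] (p * u)"
    using int_pow_mult[OF a, of "u * p" "v * N"] a uv by (simp add: mult.commute)
  then have "inv b \<otimes> a \<otimes> b = inv b \<otimes> (a [^] p) [^] u \<otimes> b"
    using a by (simp add: int_pow_pow)
  also have "\<dots> = a [^] (q * u)"
    using conj_int_pow[of "a [^] p" b u] a b eq by (simp add: int_pow_pow)
  finally show ?thesis by blast
qed

section \<open>Integer powers and roots of unity in a field\<close>

lemma power_int_chain:
  fixes x :: "nat \<Rightarrow> 'a :: field"
  assumes "\<And>k. x k powi p = x (Suc k) powi q"
  shows "x i powi (p ^ k) = x (i + k) powi (q ^ k)"
proof (induction k)
  case (Suc k)
  have "x i powi (p ^ Suc k) = (x i powi (p ^ k)) powi p"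
    by (simp add: mult.commute flip: power_int_mult)
  \<comment> \<open>Exchanging the exponents puts \<open>p\<close> directly on
    \<open>x (i + k)\<close>, where one more step of the relation applies.\<close>
  also have "\<dots> = (x (i + k) powi p) powi (q ^ k)"
    by (simp add: Suc mult.commute flip: power_int_mult)
  also have "\<dots> = x (i + Suc k) powi (q ^ Suc k)"
    by (simp add: assms flip: power_int_mult)
  finally show ?case .
qed simp

lemma power_int_eq_1_imp_power_eq_1:
  fixes x :: "'a :: field"
  assumes "x powi m = 1" "m \<noteq> 0"
  shows "\<exists>k>0. x ^ k = 1"
proof (intro exI conjI)
  show "x ^ nat \<bar>m\<bar> = 1"
    using assms(1) by (cases "m \<ge> 0") (auto simp: power_int_def power_inverse)
qed (use assms in simp)

text \<open>Iterating \<open>x\<^sup>p = y\<^sup>q\<close> inside the finite set \<open>S\<close> gives a sequence that returns to an earlier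
  point \<open>z\<close>, and then \<open>z\<close> raised to \<open>p\<^sup>d - q\<^sup>d\<close> is \<open>1\<close> for some positive \<open>d\<close>.\<close>
lemma finite_power_correspondence_root_of_unity:
  fixes S :: "'a :: field set"
  assumes "finite S" "0 \<notin> S" "\<And>x. x \<in> S \<Longrightarrow> \<exists>y\<in>S. x powi p = y powi q"
    and "p \<noteq> 0" "\<bar>p\<bar> \<noteq> \<bar>q\<bar>" and "x \<in> S"
  shows "\<exists>k>0. x ^ k = 1"
proof -
  obtain f where f: "\<And>x. x \<in> S \<Longrightarrow> f x \<in> S \<and> x powi p = f x powi q"
    using assms(3) by metis
  define y where "y k = (f ^^ k) x" for k
  have yS: "y k \<in> S" for k
    by (induction k) (use f \<open>x \<in> S\<close> in \<open>auto simp: y_def\<close>)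
  have y_step: "y k powi p = y (Suc k) powi q" for k
    using f[OF yS[of k]] by (simp add: y_def)
  have "finite (range y)"
    using finite_subset[OF _ \<open>finite S\<close>] yS by blast
  then have "\<not> inj y" using finite_imageD by blast
  then obtain i j where ij: "i < j" "y i = y j"
    by (metis injI linorder_neqE_nat)
  define d where "d = j - i"
  have "d > 0" "y (i + d) = y i" using ij by (auto simp: d_def)
  then have "y i powi (p ^ d) = y i powi (q ^ d)"
    using power_int_chain[of y p q i d, OF y_step] by simp
  moreover have "y i \<noteq> 0" using yS[of i] \<open>0 \<notin> S\<close> by metis
  ultimately have "y i powi (p ^ d - q ^ d) = 1"
    by (simp add: power_int_diff)
  \<comment> \<open>The absolute values must differ: for even \<open>d\<close> the powers of
    \<open>p\<close> and \<open>-p\<close> agree.\<close>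
  moreover have "p ^ d \<noteq> q ^ d"
    using \<open>d > 0\<close> \<open>\<bar>p\<bar> \<noteq> \<bar>q\<bar>\<close> power_eq_imp_eq_base[of "\<bar>p\<bar>" d "\<bar>q\<bar>"] by (auto simp flip: power_abs)
  ultimately obtain k where k: "k > 0" "y i ^ k = 1"
    using power_int_eq_1_imp_power_eq_1[of "y i" "p ^ d - q ^ d"] by auto
  \<comment> \<open>The chain from \<open>x = y 0\<close> to \<open>y i\<close> carries the result
    back to the starting point; the exponent is nonzero because \<open>p\<close> and
    \<open>k\<close> are.\<close>
  have "x powi (p ^ i * int k) = (y i powi (q ^ i)) powi int k"
    using power_int_chain[of y p q 0 i, OF y_step] by (simp add: y_def power_int_mult)
  also have "\<dots> = (y i ^ k) powi (q ^ i)"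
    by (simp add: mult.commute flip: power_int_mult power_int_of_nat)
  finally have "x powi (p ^ i * int k) = 1" using k by simp
  then show ?thesis
    using power_int_eq_1_imp_power_eq_1 \<open>p \<noteq> 0\<close> k by (metis mult_eq_0_iff of_nat_eq_0_iff power_eq_0_iff less_irrefl)
qed

section \<open>Diagonal and diagonalizable matrices in \<open>GL n\<close>\<close>

lemma mat_diag_power: "mat_diag n f ^\<^sub>m k = mat_diag n (\<lambda>i. f i ^ k)"
  by (induction k) (simp_all add: carrier_matD[OF mat_diag_dim] power_commutes)

lemma mat_diag_eq_one: "(\<And>i. i < n \<Longrightarrow> f i = 1) \<Longrightarrow> mat_diag n f = 1\<^sub>m n"
  by (auto simp: mat_diag_def intro!: eq_matI)

lemma mat_diag_in_GL_iff: "mat_diag n f \<in> carrier (GL n) \<longleftrightarrow> (\<forall>i<n. f i \<noteq> 0)"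
proof
  assume "mat_diag n f \<in> carrier (GL n)"
  then obtain C where C: "C \<in> carrier (GL n)" "mat_diag n f * C = 1\<^sub>m n"
    using group.r_inv[OF group_GL] group.inv_closed[OF group_GL] by force
  then have "C \<in> carrier_mat n n" by (simp add: carrier_GL)
  then have "mat n n (\<lambda>(i, j). f i * C $$ (i, j)) $$ (i, i) = 1\<^sub>m n $$ (i, i)" for i
    using C(2) by (simp add: mat_diag_mult_left)
  then have "f i * C $$ (i, i) = 1" if "i < n" for i
    using that by (metis (no_types, lifting) index_mat(1) index_one_mat(1) case_prod_conv)
  then show "\<forall>i<n. f i \<noteq> 0" by force
next
  assume f: "\<forall>i<n. f i \<noteq> 0"
  have "mat_diag n f * mat_diag n (\<lambda>i. inverse (f i)) = 1\<^sub>m n"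
    and "mat_diag n (\<lambda>i. inverse (f i)) * mat_diag n f = 1\<^sub>m n"
    using f by (auto intro: mat_diag_eq_one)
  then show "mat_diag n f \<in> carrier (GL n)"
    unfolding carrier_GL invertible_mat_def inverts_mat_def
    by (metis carrier_matD mat_diag_dim square_mat.simps)
qed

lemma mat_diag_int_pow:
  assumes "mat_diag n f \<in> carrier (GL n)"
  shows "mat_diag n f [^]\<^bsub>GL n\<^esub> (k :: int) = mat_diag n (\<lambda>i. f i powi k)"
proof -
  interpret group "GL n" by (rule group_GL)
  have nat: "mat_diag n f [^]\<^bsub>GL n\<^esub> int m = mat_diag n (\<lambda>i. f i ^ m)" for m
    by (simp add: int_pow_int nat_pow_GL mat_diag_power)
  show ?thesis
  proof (cases "k \<ge> 0")
    case True
    then obtain m where "k = int m" by (metis nonneg_int_cases)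
    then show ?thesis using nat by simp
  next
    case False
    then obtain m where k: "k = - int m" by (metis nle_le nonpos_int_cases)
    have nz: "\<forall>i<n. f i \<noteq> 0" using assms mat_diag_in_GL_iff by blast
    \<comment> \<open>A negative power is a group inverse, which is identified by exhibiting a left
      inverse.\<close>
    have "mat_diag n (\<lambda>i. f i powi k) * mat_diag n (\<lambda>i. f i ^ m) = 1\<^sub>m n"
      using nz by (auto simp: k power_int_minus intro: mat_diag_eq_one)
    then have "inv\<^bsub>GL n\<^esub> (mat_diag n (\<lambda>i. f i ^ m)) = mat_diag n (\<lambda>i. f i powi k)"
      using nz by (intro inv_equality) (auto simp: mat_diag_in_GL_iff)
    then show ?thesis using assms nat by (simp add: k int_pow_neg)
  qed
qed

text \<open>Similarity supplies mutually inverse \<open>P\<close> and \<open>Q\<close> with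
  \<open>A = P * D * Q\<close>. Recognizing \<open>Q\<close> as the group inverse of
  \<open>P\<close> turns diagonalization into conjugation inside \<open>GL n\<close>.\<close>

lemma diagonalizable_in_GL:
  assumes "A \<in> carrier (GL n)" "diagonalizable A"
  obtains P f where "P \<in> carrier (GL n)" "mat_diag n f \<in> carrier (GL n)"
    "inv\<^bsub>GL n\<^esub> P * A * P = mat_diag n f"
proof -
  interpret group "GL n" by (rule group_GL)
  obtain D P Q where D: "diagonal_mat D" and w: "similar_mat_wit A D P Q"
    using assms by (auto simp: diagonalizable_def similar_mat_def)
  have A: "A \<in> carrier_mat n n" using assms by (simp add: carrier_GL)
  note w = similar_mat_witD2[OF A w]
  have P: "P \<in> carrier (GL n)" using w by (auto simp: carrier_GL invertible_mat_def inverts_mat_def)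
  have Q: "Q \<in> carrier (GL n)" using w by (auto simp: carrier_GL invertible_mat_def inverts_mat_def)
  have inv: "inv\<^bsub>GL n\<^esub> P = Q" using P Q w inv_equality[of Q P] by simp
  have QPD: "Q * (P * D) = D"
    using w assoc_mult_mat[of Q n n P n D n] by simp
  have "Q * A * P = Q * (P * D) * (Q * P)"
    using w by (simp add: assoc_mult_mat[of _ n n _ n _ n] mult_carrier_mat[of _ n n _ n])
  then have QAP: "Q * A * P = D" using w QPD by simp
  define f where "f i = D $$ (i, i)" for i
  have Df: "D = mat_diag n f"
    using D w by (auto simp: diagonal_mat_def mat_diag_def f_def intro!: eq_matI)
  have "Q * A * P \<in> carrier (GL n)"
    using P Q assms m_closed by (metis mult_GL)
  then show thesis using that[OF P, of f] inv QAP Df by simp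
qed

text \<open>A zero row \<open>i\<close> of \<open>C\<close> would make the entry
  \<open>(i, i)\<close> of \<open>C\<close> times its inverse vanish.\<close>

lemma invertible_row_nonzero:
  assumes "C \<in> carrier (GL n)" "i < n"
  shows "\<exists>j<n. C $$ (i, j) \<noteq> 0"
proof (rule ccontr)
  assume zero: "\<not> ?thesis"
  obtain X where X: "X \<in> carrier (GL n)" "C * X = 1\<^sub>m n"
    using group.r_inv[OF group_GL assms(1)] group.inv_closed[OF group_GL assms(1)] by auto
  have "(C * X) $$ (i, i) = (\<Sum>j<n. C $$ (i, j) * X $$ (j, i))"
    using assms X(1) by (auto simp: carrier_GL scalar_prod_def atLeast0LessThan)
  also have "\<dots> = 0" using zero by simp
  finally show False using assms(2) by (simp add: X(2) del: index_mult_mat)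
qed

text \<open>Comparing entries in \<open>D\<^sup>p C = C D\<^sup>q\<close> for \<open>D = mat_diag n f\<close>: every row of \<open>C\<close> has a nonzero entry.\<close>
lemma mat_diag_conj_power_correspondence:
  assumes D: "mat_diag n f \<in> carrier (GL n)" and C: "C \<in> carrier (GL n)"
    and eq: "inv\<^bsub>GL n\<^esub> C * (mat_diag n f [^]\<^bsub>GL n\<^esub> (p :: int)) * C = mat_diag n f [^]\<^bsub>GL n\<^esub> (q :: int)"
    and "i < n"
  shows "\<exists>j<n. f i powi p = f j powi q"
proof -
  interpret group "GL n" by (rule group_GL)
  obtain j where j: "j < n" "C $$ (i, j) \<noteq> 0" using invertible_row_nonzero[OF C \<open>i < n\<close>] by blast
  have Cm: "C \<in> carrier_mat n n" using C by (simp add: carrier_GL)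
  have "mat_diag n f [^]\<^bsub>GL n\<^esub> p \<otimes>\<^bsub>GL n\<^esub> C = C \<otimes>\<^bsub>GL n\<^esub> mat_diag n f [^]\<^bsub>GL n\<^esub> q"
    using conj_eq_imp_commute[OF int_pow_closed[OF D] C] eq by simp
  then have "(mat_diag n (\<lambda>i. f i powi p) * C) $$ (i, j) = (C * mat_diag n (\<lambda>i. f i powi q)) $$ (i, j)"
    using D by (simp add: mat_diag_int_pow)
  then have "f i powi p * C $$ (i, j) = C $$ (i, j) * f j powi q"
    using j \<open>i < n\<close> by (simp add: mat_diag_mult_left[OF Cm] mat_diag_mult_right[OF Cm])
  then show ?thesis using j by auto
qed

section \<open>The order of \<open>A\<close> and its conjugate by \<open>B\<close>\<close>

theorem proposition3:
  fixes p q :: int and n :: nat and A B :: "complex mat"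
  assumes "coprime p q"
    and "\<bar>p\<bar> + \<bar>q\<bar> > 2"
    and "n \<ge> 1"
    and "A \<in> carrier (GL n)"
    and "B \<in> carrier (GL n)"
    and "inv\<^bsub>GL n\<^esub> B * (A [^]\<^bsub>GL n\<^esub> p) * B = A [^]\<^bsub>GL n\<^esub> q"
    and "diagonalizable A"
  shows "root_of_one_mat n A \<and> power_of_mat n A (inv\<^bsub>GL n\<^esub> B * A * B)"
proof -
  interpret group "GL n" by (rule group_GL)
  note A = \<open>A \<in> carrier (GL n)\<close> and B = \<open>B \<in> carrier (GL n)\<close>
  \<comment> \<open>If \<open>p = 0\<close>, coprimality forces \<open>\<bar>q\<bar> = 1\<close>,
    and the sum of absolute values is only 1.\<close>
  have p0: "p \<noteq> 0" using assms(1,2) by auto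
  have pq: "\<bar>p\<bar> \<noteq> \<bar>q\<bar>"
  proof
    assume "\<bar>p\<bar> = \<bar>q\<bar>"
    then have "p dvd q" by (metis abs_dvd_iff dvd_abs_iff dvd_refl)
    then have "\<bar>p\<bar> = 1" using assms(1) coprime_common_divisor[of p q p] by simp
    with \<open>\<bar>p\<bar> = \<bar>q\<bar>\<close> assms(2) show False by simp
  qed
  obtain P f where P: "P \<in> carrier (GL n)" and D: "mat_diag n f \<in> carrier (GL n)"
    and PAP: "inv\<^bsub>GL n\<^esub> P * A * P = mat_diag n f"
    using diagonalizable_in_GL[OF A \<open>diagonalizable A\<close>] .
  \<comment> \<open>As a group endomorphism, \<open>h\<close> sends the relation between
    \<open>A\<close> and \<open>B\<close> to the same relation between \<open>mat_diag n f\<close>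
    and \<open>h B\<close>.\<close>
  define h where "h x = inv\<^bsub>GL n\<^esub> P \<otimes>\<^bsub>GL n\<^esub> x \<otimes>\<^bsub>GL n\<^esub> P" for x
  have "h \<in> hom (GL n) (GL n)" using conj_hom[OF P] by (simp add: h_def[abs_def])
  then interpret h: group_hom "GL n" "GL n" h
    by unfold_locales
  have hA: "h A = mat_diag n f" using PAP by (simp add: h_def)
  have "h (inv\<^bsub>GL n\<^esub> B \<otimes>\<^bsub>GL n\<^esub> (A [^]\<^bsub>GL n\<^esub> p) \<otimes>\<^bsub>GL n\<^esub> B) = h (A [^]\<^bsub>GL n\<^esub> q)"
    using assms(6) by simp
  then have "inv\<^bsub>GL n\<^esub> (h B) * (mat_diag n f [^]\<^bsub>GL n\<^esub> p) * h B = mat_diag n f [^]\<^bsub>GL n\<^esub> q"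
    using A B by (simp add: hA h.hom_int_pow del: mult_GL) simp
  then have corr: "\<exists>j<n. f i powi p = f j powi q" if "i < n" for i
    using mat_diag_conj_power_correspondence[OF D h.hom_closed[OF B]] that by blast
  have "\<exists>k>0. f i ^ k = 1" if "i < n" for i
  proof (rule finite_power_correspondence_root_of_unity[of "f ` {..<n}" p q])
    show "0 \<notin> f ` {..<n}" using D by (auto simp: mat_diag_in_GL_iff)
  qed (use corr that p0 pq in auto)
  then obtain k where k: "\<And>i. i < n \<Longrightarrow> k i > 0 \<and> f i ^ k i = 1" by metis
  \<comment> \<open>A common exponent for all eigenvalues: a multiple of every
    \<open>k i\<close>.\<close>
  define K where "K = (\<Prod>i<n. k i)"
  have "K > 0" using k by (auto simp: K_def intro!: prod_pos)
  have "f i ^ K = 1" if "i < n" for i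
  proof -
    have "k i dvd K" using that by (auto simp: K_def intro: dvd_prodI)
    then show ?thesis using k[OF that] by (auto simp: power_mult)
  qed
  then have "mat_diag n f ^\<^sub>m K = 1\<^sub>m n"
    by (simp add: mat_diag_power mat_diag_eq_one)
  then have "h (A [^]\<^bsub>GL n\<^esub> K) = h \<one>\<^bsub>GL n\<^esub>"
    using A by (simp add: h.hom_nat_pow hA nat_pow_GL del: one_GL) simp
  \<comment> \<open>Injectivity of \<open>h\<close> lifts the triviality of the \<open>K\<close>-th
    power from the diagonal matrix to \<open>A\<close>.\<close>
  moreover have "h x = h y \<Longrightarrow> x = y" if "x \<in> carrier (GL n)" "y \<in> carrier (GL n)" for x y
    using that P by (simp add: h_def del: mult_GL)
  ultimately have AK: "A [^]\<^bsub>GL n\<^esub> K = \<one>\<^bsub>GL n\<^esub>" using A by blast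
  have Am: "A \<in> carrier_mat n n" using A by (simp add: carrier_GL)
  have "root_of_one_mat n A"
    using AK Am \<open>K > 0\<close> by (auto simp: root_of_one_mat_def nat_pow_GL)
  \<comment> \<open>An element of infinite order has \<open>ord\<close> equal to 0; here
    \<open>ord A\<close> divides the positive \<open>K\<close>.\<close>
  moreover have "ord A > 0"
    using AK pow_eq_id[OF A, of K] \<open>K > 0\<close> by (auto intro: dvd_pos_nat)
  then have "power_of_mat n A (inv\<^bsub>GL n\<^esub> B * A * B)"
    using conj_eq_int_pow[OF A B _ assms(1)] assms(6) by (simp add: power_of_mat_def)
  ultimately show ?thesis ..
qed

end
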